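(* The non-classical implication semilattices are exactly the divisible relatively residuated join-semilattices $(R,\vee,\odot,\rightarrow,1)$ satisfying, for all $x,y,z\in R$, (i) $x\odot x=x$, (ii) $y\leq(x\vee z)\rightarrow\big((x\vee z)\odot(y\vee z)\big)$, where $\odot$ plays the role of $\wedge$. That is: if $(S,\vee,\wedge,\rightarrow,1)$ is a non-classical implication semilattice then, with $\odot:=\wedge$, it is a divisible relatively residuated join-semilattice satisfying (i) and (ii); and conversely, if $(R,\vee,\odot,\rightarrow,1)$ is a divisible relatively residuated join-semilattice satisfying (i) and (ii), then $(R,\vee,\odot,\rightarrow,1)$ is a non-classical implication semilattice with $\odot$ as its partial meet operation.
   Context: In a join-semilattice $(S,\vee,1)$ with top element $1$, the order is $x\leq y$ iff $x\vee y=y$. Throughout, $x\wedge y$ denotes the infimum of $x$ and $y$, a partial operation. A non-classical implication semilattice is a quintuple $(S,\vee,\wedge,\rightarrow,1)$ where $(S,\vee,1)$ is a join-semilattice with top element $1$, the infimum $x\wedge y$ exists if and only if $x$ and $y$ have a common lower bound, and $\rightarrow$ is a binary operation on $S$ such that for all $x,y,z\in S$: (1) $y\leq x\rightarrow y$; (2) $(x\vee y)\wedge(x\rightarrow y)=y$; (3) $(x\vee y)\rightarrow y=x\rightarrow y$; (4) $y\leq(x\vee z)\rightarrow\big((x\vee z)\wedge(y\vee z)\big)$. A relatively residuated join-semilattice is a partial algebra $(R,\vee,\odot,\rightarrow,1)$ of type $(2,2,2,0)$ where $\vee,\rightarrow$ are (total) binary operations, $x\odot y$ is defined if and only if $x$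 and $y$ have a common lower bound, and in this case $z\leq x\odot y$ for all $z\in R$ with $z\leq x,y$, and for all $x,y,z\in R$: (10) $(R,\vee,1)$ is a join-semilattice with top element $1$; (11) $x\odot1=1\odot x=x$; (12) $x\odot y=y\odot x$ whenever $x$ and $y$ have a common lower bound; (13) $(x\odot y)\odot z=x\odot(y\odot z)$ whenever $x,y,z$ have a common lower bound; (14) $x\leq y$ implies $x\odot z\leq y\odot z$ whenever $x$ and $z$ have a common lower bound; (15) $(x\vee z)\odot(y\vee z)\leq z$ if and only if $x\vee z\leq y\rightarrow z$; (16) $(x\vee y)\rightarrow y=x\rightarrow y$. It is called divisible if $(x\vee y)\odot(x\rightarrow y)=y$ for all $x,y\in R$. *)

theory Defs
  imports Main
begin

(* The universe of every structure is the (nonempty) type 'a. A partial binary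
   operation is a function into 'a option, None meaning "undefined".
   An equation t = Some y between such terms asserts that t is defined and equals y. *)

definition join_le :: "('a \<Rightarrow> 'a \<Rightarrow> 'a) \<Rightarrow> 'a \<Rightarrow> 'a \<Rightarrow> bool"
  where "join_le join x y \<longleftrightarrow> join x y = y"

locale join_semilattice_top = semilattice join
  for join :: "'a \<Rightarrow> 'a \<Rightarrow> 'a" (infixl "\<squnion>" 65) +
  fixes one :: 'a ("\<one>")
  assumes join_one: "join_le (\<squnion>) x \<one>"
begin

abbreviation le :: "'a \<Rightarrow> 'a \<Rightarrow> bool" (infix "\<sqsubseteq>" 50)
  where "x \<sqsubseteq> y \<equiv> join_le (\<squnion>) x y"

definition has_common_lb :: "'a set \<Rightarrow> bool"
  where "has_common_lb A \<longleftrightarrow> (\<exists>u. \<forall>a\<in>A. u \<sqsubseteq> a)"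

definition is_infimum :: "'a \<Rightarrow> 'a \<Rightarrow> 'a \<Rightarrow> bool"
  where "is_infimum x y m \<longleftrightarrow>
    m \<sqsubseteq> x \<and> m \<sqsubseteq> y \<and> (\<forall>u. u \<sqsubseteq> x \<and> u \<sqsubseteq> y \<longrightarrow> u \<sqsubseteq> m)"

end

locale nonclassical_implication_semilattice = join_semilattice_top join one
  for join :: "'a \<Rightarrow> 'a \<Rightarrow> 'a" (infixl "\<squnion>" 65)
    and meet :: "'a \<Rightarrow> 'a \<Rightarrow> 'a option" (infixl "\<sqinter>" 70)
    and imp :: "'a \<Rightarrow> 'a \<Rightarrow> 'a" (infixr "\<rightarrow>" 60)
    and one :: 'a ("\<one>") +
  assumes meet_iff_infimum: "x \<sqinter> y = Some m \<longleftrightarrow> is_infimum x y m"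
    and infimum_exists_iff: "(\<exists>m. is_infimum x y m) \<longleftrightarrow> has_common_lb {x, y}"
    and le_imp: "y \<sqsubseteq> x \<rightarrow> y"
    and join_meet_imp: "(x \<squnion> y) \<sqinter> (x \<rightarrow> y) = Some y"
    and join_imp: "(x \<squnion> y) \<rightarrow> y = x \<rightarrow> y"
    and le_join_imp_meet:
      "\<exists>m. (x \<squnion> z) \<sqinter> (y \<squnion> z) = Some m \<and> y \<sqsubseteq> (x \<squnion> z) \<rightarrow> m"

locale relatively_residuated_join_semilattice = join_semilattice_top join one
  for join :: "'a \<Rightarrow> 'a \<Rightarrow> 'a" (infixl "\<squnion>" 65)
    and mult :: "'a \<Rightarrow> 'a \<Rightarrow> 'a option" (infixl "\<odot>" 70)
    and imp :: "'a \<Rightarrow> 'a \<Rightarrow> 'a" (infixr "\<rightarrow>" 60)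
    and one :: 'a ("\<one>") +
  assumes mult_defined_iff: "(\<exists>p. x \<odot> y = Some p) \<longleftrightarrow> has_common_lb {x, y}"
    and lb_le_mult: "x \<odot> y = Some p \<Longrightarrow> z \<sqsubseteq> x \<Longrightarrow> z \<sqsubseteq> y \<Longrightarrow> z \<sqsubseteq> p"
    and mult_one: "x \<odot> \<one> = Some x"
    and one_mult: "\<one> \<odot> x = Some x"
    and mult_commute: "has_common_lb {x, y} \<Longrightarrow> x \<odot> y = y \<odot> x"
    and mult_assoc: "has_common_lb {x, y, z} \<Longrightarrow>
      \<exists>p q r. x \<odot> y = Some p \<and> y \<odot> z = Some q \<and> p \<odot> z = Some r \<and> x \<odot> q = Some r"
    and mult_mono: "x \<sqsubseteq> y \<Longrightarrow> has_common_lb {x, z} \<Longrightarrow>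
      \<exists>p q. x \<odot> z = Some p \<and> y \<odot> z = Some q \<and> p \<sqsubseteq> q"
    and residuation: "(\<exists>p. (x \<squnion> z) \<odot> (y \<squnion> z) = Some p \<and> p \<sqsubseteq> z) \<longleftrightarrow> x \<squnion> z \<sqsubseteq> y \<rightarrow> z"
    and join_imp: "(x \<squnion> y) \<rightarrow> y = x \<rightarrow> y"

locale divisible_relatively_residuated_join_semilattice =
  relatively_residuated_join_semilattice join mult imp one
  for join :: "'a \<Rightarrow> 'a \<Rightarrow> 'a" (infixl "\<squnion>" 65)
    and mult :: "'a \<Rightarrow> 'a \<Rightarrow> 'a option" (infixl "\<odot>" 70)
    and imp :: "'a \<Rightarrow> 'a \<Rightarrow> 'a" (infixr "\<rightarrow>" 60)
    and one :: 'a ("\<one>") +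
  assumes divisible: "(x \<squnion> y) \<odot> (x \<rightarrow> y) = Some y"

end

theory Submission
  imports Defs
begin

text \<open>Since the product is monotone with unit the top element, it lies below both factors, so it is
  the infimum. Conversely, residuation for \<open>\<odot> = \<and>\<close> reduces to divisibility in one direction; in the
  other, \<open>(x \<or> z) \<and> (y \<or> z) \<le> z\<close> forces this infimum to be \<open>z\<close>, and then axiom (4) with \<open>x\<close> and
  \<open>y\<close> exchanged gives \<open>x \<le> (y \<or> z) \<rightarrow> z = y \<rightarrow> z\<close>.\<close>

context join_semilattice_top
begin

lemma le_refl: "x \<sqsubseteq> x"
  by (simp add: join_le_def)

lemma le_trans: "x \<sqsubseteq> y \<Longrightarrow> y \<sqsubseteq> z \<Longrightarrow> x \<sqsubseteq> z"
  unfolding join_le_def by (metis assoc)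

lemma le_antisym: "x \<sqsubseteq> y \<Longrightarrow> y \<sqsubseteq> x \<Longrightarrow> x = y"
  unfolding join_le_def by (metis commute)

lemma le_join2: "y \<sqsubseteq> x \<squnion> y"
  by (simp add: join_le_def left_commute)

lemma join_least: "x \<sqsubseteq> z \<Longrightarrow> y \<sqsubseteq> z \<Longrightarrow> x \<squnion> y \<sqsubseteq> z"
  by (simp add: join_le_def assoc)

lemma has_common_lb_pair: "has_common_lb {x, y} \<longleftrightarrow> (\<exists>u. u \<sqsubseteq> x \<and> u \<sqsubseteq> y)"
  by (simp add: has_common_lb_def)

lemma has_common_lb_triple: "has_common_lb {x, y, z} \<longleftrightarrow> (\<exists>u. u \<sqsubseteq> x \<and> u \<sqsubseteq> y \<and> u \<sqsubseteq> z)"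
  by (simp add: has_common_lb_def)

lemma is_infimum_unique: "is_infimum x y m \<Longrightarrow> is_infimum x y n \<Longrightarrow> m = n"
  unfolding is_infimum_def by (blast intro: le_antisym)

end

context nonclassical_implication_semilattice
begin

lemma meet_defined: "u \<sqsubseteq> x \<Longrightarrow> u \<sqsubseteq> y \<Longrightarrow> \<exists>m. x \<sqinter> y = Some m"
  using infimum_exists_iff has_common_lb_pair meet_iff_infimum by blast

lemma meet_eq_Some_absorb: "x \<sqsubseteq> y \<Longrightarrow> x \<sqinter> y = Some x"
  unfolding meet_iff_infimum is_infimum_def by (blast intro: le_refl)

lemma meet_commute: "x \<sqinter> y = y \<sqinter> x"
proof -
  \<comment> \<open>Two \<open>option\<close> values that agree on every \<open>Some m\<close> are
    equal, so this also settles the case where both meets are undefined.\<close>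
  have "x \<sqinter> y = Some m \<longleftrightarrow> y \<sqinter> x = Some m" for m
    unfolding meet_iff_infimum is_infimum_def by blast
  then show ?thesis
    by (metis not_None_eq)
qed

text \<open>Both bracketings are the greatest lower bound of the three elements; the common bound
  \<open>u\<close> ensures that all the meets involved exist.\<close>

lemma meet_assoc:
  assumes "u \<sqsubseteq> x" "u \<sqsubseteq> y" "u \<sqsubseteq> z"
  shows "\<exists>p q r. x \<sqinter> y = Some p \<and> y \<sqinter> z = Some q \<and> p \<sqinter> z = Some r \<and> x \<sqinter> q = Some r"
proof -
  obtain p q where p: "x \<sqinter> y = Some p" and q: "y \<sqinter> z = Some q"
    using assms meet_defined by meson
  have "u \<sqsubseteq> p"
    using p assms unfolding meet_iff_infimum is_infimum_def by blast
  then obtain r where r: "p \<sqinter> z = Some r"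
    using assms meet_defined by meson
  \<comment> \<open>Definedness needs no separate argument: \<open>r\<close> is checked to be the
    infimum of \<open>x\<close> and \<open>q\<close>, which determines the value of the
    meet.\<close>
  have "x \<sqinter> q = Some r"
    using p q r unfolding meet_iff_infimum is_infimum_def by (meson le_trans)
  with p q r show ?thesis
    by blast
qed

lemma meet_mono:
  assumes "x \<sqsubseteq> y" "u \<sqsubseteq> x" "u \<sqsubseteq> z"
  shows "\<exists>p q. x \<sqinter> z = Some p \<and> y \<sqinter> z = Some q \<and> p \<sqsubseteq> q"
proof -
  obtain p q where p: "x \<sqinter> z = Some p" and q: "y \<sqinter> z = Some q"
    using assms meet_defined le_trans by meson
  moreover have "p \<sqsubseteq> q"
    using p q assms(1) unfolding meet_iff_infimum is_infimum_def by (meson le_trans)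
  ultimately show ?thesis
    by blast
qed

lemma meet_residuation:
  "(\<exists>p. (x \<squnion> z) \<sqinter> (y \<squnion> z) = Some p \<and> p \<sqsubseteq> z) \<longleftrightarrow> x \<squnion> z \<sqsubseteq> y \<rightarrow> z"
proof
  assume "\<exists>p. (x \<squnion> z) \<sqinter> (y \<squnion> z) = Some p \<and> p \<sqsubseteq> z"
  then obtain p where p: "(x \<squnion> z) \<sqinter> (y \<squnion> z) = Some p" "p \<sqsubseteq> z"
    by blast
  \<comment> \<open>\<open>z\<close> lies below both joins, hence below their infimum.\<close>
  have "z \<sqsubseteq> p"
    using p(1) le_join2 unfolding meet_iff_infimum is_infimum_def by blast
  with p have "(y \<squnion> z) \<sqinter> (x \<squnion> z) = Some z"
    using le_antisym meet_commute by metis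
  then have "x \<sqsubseteq> (y \<squnion> z) \<rightarrow> z"
    using le_join_imp_meet[of y z x] by auto
  \<comment> \<open>\<open>join_imp\<close> turns the bound on \<open>x\<close> into
    \<open>x \<sqsubseteq> y \<rightarrow> z\<close>, and \<open>le_imp\<close> puts
    \<open>z\<close> below the same element.\<close>
  then show "x \<squnion> z \<sqsubseteq> y \<rightarrow> z"
    using join_imp le_imp join_least by metis
next
  assume le: "x \<squnion> z \<sqsubseteq> y \<rightarrow> z"
  \<comment> \<open>The common lower bound that makes this meet defined is \<open>z\<close>.\<close>
  obtain p where p: "(x \<squnion> z) \<sqinter> (y \<squnion> z) = Some p"
    using meet_defined le_join2 by meson
  \<comment> \<open>\<open>p\<close> is below \<open>y \<squnion> z\<close> and, through
    \<open>x \<squnion> z\<close>, below \<open>y \<rightarrow> z\<close>; the infimum of these two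
    is \<open>z\<close>.\<close>
  have "p \<sqsubseteq> z"
    using p le join_meet_imp[of y z] unfolding meet_iff_infimum is_infimum_def
    by (meson le_trans)
  with p show "\<exists>p. (x \<squnion> z) \<sqinter> (y \<squnion> z) = Some p \<and> p \<sqsubseteq> z"
    by blast
qed

lemma divisible_relatively_residuated:
  "divisible_relatively_residuated_join_semilattice (\<squnion>) (\<sqinter>) (\<rightarrow>) \<one>"
proof unfold_locales
  show "(\<exists>p. x \<sqinter> y = Some p) \<longleftrightarrow> has_common_lb {x, y}" for x y
    using infimum_exists_iff meet_iff_infimum by simp
  show "z \<sqsubseteq> p" if "x \<sqinter> y = Some p" "z \<sqsubseteq> x" "z \<sqsubseteq> y" for x y z p
    using that unfolding meet_iff_infimum is_infimum_def by blast
  show "x \<sqinter> \<one> = Some x" for x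
    by (simp add: meet_eq_Some_absorb join_one)
  then show "\<one> \<sqinter> x = Some x" for x
    using meet_commute by metis
  show "x \<sqinter> y = y \<sqinter> x" for x y
    by (rule meet_commute)
  show "\<exists>p q r. x \<sqinter> y = Some p \<and> y \<sqinter> z = Some q \<and> p \<sqinter> z = Some r \<and> x \<sqinter> q = Some r"
    if "has_common_lb {x, y, z}" for x y z
    using that meet_assoc unfolding has_common_lb_triple by blast
  show "\<exists>p q. x \<sqinter> z = Some p \<and> y \<sqinter> z = Some q \<and> p \<sqsubseteq> q"
    if "x \<sqsubseteq> y" "has_common_lb {x, z}" for x y z
    using that meet_mono unfolding has_common_lb_pair by blast
qed (fact meet_residuation join_imp join_meet_imp)+

end

context relatively_residuated_join_semilattice
begin

lemma mult_le1:
  assumes "x \<odot> y = Some p"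
  shows "p \<sqsubseteq> x"
proof -
  \<comment> \<open>The factors are swapped because \<open>mult_mono\<close> acts on the left one:
    from \<open>y \<sqsubseteq> \<one>\<close> it puts \<open>y \<odot> x\<close> below
    \<open>\<one> \<odot> x\<close>, which is \<open>x\<close>.\<close>
  have lb: "has_common_lb {y, x}"
    using assms mult_defined_iff by (metis insert_commute)
  from mult_mono[OF join_one this] show ?thesis
    using assms mult_commute[OF lb] one_mult by auto
qed

lemma mult_eq_Some_iff_is_infimum: "x \<odot> y = Some m \<longleftrightarrow> is_infimum x y m"
proof -
  have inf: "is_infimum x y p" if p: "x \<odot> y = Some p" for p
  proof -
    \<comment> \<open>With the factors exchanged, \<open>mult_le1\<close> also bounds
      \<open>p\<close> by \<open>y\<close>.\<close>
    have "y \<odot> x = Some p"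
      using p mult_defined_iff mult_commute by metis
    then show ?thesis
      using p mult_le1 lb_le_mult unfolding is_infimum_def by blast
  qed
  show ?thesis
  proof
    assume m: "is_infimum x y m"
    \<comment> \<open>The infimum \<open>m\<close> is itself a common lower bound, so the product
      exists; uniqueness of infima then identifies it with \<open>m\<close>.\<close>
    then obtain p where "x \<odot> y = Some p"
      using mult_defined_iff unfolding has_common_lb_pair is_infimum_def by blast
    with inf m show "x \<odot> y = Some m"
      using is_infimum_unique by blast
  qed (fact inf)
qed

end

lemma (in divisible_relatively_residuated_join_semilattice) nonclassical_implication_semilattice:
  assumes "\<And>x y z. \<exists>m. (x \<squnion> z) \<odot> (y \<squnion> z) = Some m \<and> y \<sqsubseteq> (x \<squnion> z) \<rightarrow> m"
  shows "nonclassical_implication_semilattice (\<squnion>) (\<odot>) (\<rightarrow>) \<one>"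
proof unfold_locales
  show "(\<exists>m. is_infimum x y m) \<longleftrightarrow> has_common_lb {x, y}" for x y
    using mult_defined_iff mult_eq_Some_iff_is_infimum by simp
  \<comment> \<open>By divisibility \<open>y\<close> is the infimum of \<open>x \<squnion> y\<close>
    and \<open>x \<rightarrow> y\<close>, so it lies below the latter.\<close>
  show "y \<sqsubseteq> x \<rightarrow> y" for x y
    using divisible[of x y] unfolding mult_eq_Some_iff_is_infimum is_infimum_def by blast
qed (fact mult_eq_Some_iff_is_infimum divisible join_imp assms)+

theorem theorem4p7:
  fixes join :: "'a \<Rightarrow> 'a \<Rightarrow> 'a"
    and mult :: "'a \<Rightarrow> 'a \<Rightarrow> 'a option"
    and imp :: "'a \<Rightarrow> 'a \<Rightarrow> 'a"
    and one :: 'a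
  shows "nonclassical_implication_semilattice join mult imp one \<longleftrightarrow>
    divisible_relatively_residuated_join_semilattice join mult imp one \<and>
    (\<forall>x. mult x x = Some x) \<and>
    (\<forall>x y z. \<exists>m. mult (join x z) (join y z) = Some m \<and> join_le join y (imp (join x z) m))"
    (is "?N \<longleftrightarrow> ?D \<and> ?I \<and> ?E")
proof
  assume ?N
  then interpret nonclassical_implication_semilattice join mult imp one .
  show "?D \<and> ?I \<and> ?E"
    using divisible_relatively_residuated meet_eq_Some_absorb[OF le_refl] le_join_imp_meet by blast
next
  assume R: "?D \<and> ?I \<and> ?E"
  then interpret divisible_relatively_residuated_join_semilattice join mult imp one
    by blast
  show ?N
    using R nonclassical_implication_semilattice by blast
qed

end
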